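(* Let $X$ be an arbitrary real Banach space (of dimension at least $2$). Then $\lambda_X^+(\tau) \asymp \rho_X(\tau)$ as $\tau \to 0$, and for any $r \in [0, \frac{1}{2}]$: $$\rho_X\left(\frac{r}{2}\right) \le \lambda_X^+(r) \le \rho_X(2r).$$
   Context: Let $X$ be a real Banach space with $\dim X \ge 2$. Write $S_X=\{x\in X:\|x\|=1\}$. For $x\in X\setminus\{0\}$ and $y\in X$, $y$ is quasiorthogonal to $x$, written $y\urcorner x$, if there is a functional $p\in X^*$ with $\|p\|=1$, $p(x)=\|x\|$ and $p(y)=0$. For $x,y\in S_X$ with $y\urcorner x$ and $r\in[0,1]$ put $\lambda_X(x,y,r)=\min\{\lambda\in\mathbb{R}:\ \|x+ry-\lambda x\|=1\}$. The modulus of supporting smoothness is $$\lambda_X^+(r)=\sup\{\lambda_X(x,y,t):\ x,y\in S_X,\ y\urcorner x,\ 0\le t\le r\},\quad r\in[0,1].$$ The modulus of smoothness is $\rho_X(\tau)=\sup\{\frac{\|x+y\|}{2}+\frac{\|x-y\|}{2}-1:\ \|x\|=1,\ \|y\|=\tau\}$, $\tau\ge0$. Two non-negative functions $f,g$, each defined on a segment with left endpoint $0$, are equivalent at zero, written $f(t)\asymp g(t)$ as $t\to0$, if there are positive constants $a,b,c,d,e$ such that $a f(bt)\le g(t)\le c f(dt)$ for all $t\in[0,e]$. *)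

theory Defs
  imports "HOL-Analysis.Analysis"
begin

(* Functionals are elements of the dual space, with its operator norm. *)
definition quasiorthogonal :: "'a::real_normed_vector \<Rightarrow> 'a \<Rightarrow> bool" where
  "quasiorthogonal y x \<longleftrightarrow>
     x \<noteq> 0 \<and> (\<exists>p :: 'a \<Rightarrow>\<^sub>L real.
       norm p = 1 \<and> blinfun_apply p x = norm x \<and> blinfun_apply p y = 0)"

(* The minimum exists whenever x and y are unit vectors, y is quasiorthogonal to x and
   0 \<le> r \<le> 1: the norm is > 1 for l < 0 (apply the functional), \<ge> 1 at l = 0 and
   equal to r \<le> 1 at l = 1. *)
definition supp_lambda :: "'a::real_normed_vector \<Rightarrow> 'a \<Rightarrow> real \<Rightarrow> real" where
  "supp_lambda x y r = (LEAST l. norm (x + r *\<^sub>R y - l *\<^sub>R x) = 1)"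

(* For dim X \<ge> 2 the supremum is over a nonempty set, and by the remark above the set lies
   in [0,1] when 0 \<le> r \<le> 1, so Sup on the reals is the genuine supremum. *)
definition supp_smoothness_modulus :: "'a::real_normed_vector itself \<Rightarrow> real \<Rightarrow> real" where
  "supp_smoothness_modulus _ r =
     Sup {supp_lambda x y t | (x :: 'a) y t.
            norm x = 1 \<and> norm y = 1 \<and> quasiorthogonal y x \<and> 0 \<le> t \<and> t \<le> r}"

(* For \<tau> \<ge> 0 the set is nonempty (in a nontrivial space) and bounded above by \<tau>. *)
definition smoothness_modulus :: "'a::real_normed_vector itself \<Rightarrow> real \<Rightarrow> real" where
  "smoothness_modulus _ \<tau> =
     Sup {norm (x + y) / 2 + norm (x - y) / 2 - 1 | (x :: 'a) y. norm x = 1 \<and> norm y = \<tau>}"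

(* D and E are the domains of f and g; every argument at which f or g is evaluated
   is required to lie in the respective domain. *)
definition equivalent_at_zero ::
    "real set \<Rightarrow> (real \<Rightarrow> real) \<Rightarrow> real set \<Rightarrow> (real \<Rightarrow> real) \<Rightarrow> bool" where
  "equivalent_at_zero D f E g \<longleftrightarrow>
     (\<forall>t\<in>D. 0 \<le> f t) \<and> (\<forall>t\<in>E. 0 \<le> g t) \<and>
     (\<exists>a b c d e :: real. 0 < a \<and> 0 < b \<and> 0 < c \<and> 0 < d \<and> 0 < e \<and>
        (\<forall>t\<in>{0..e}. b * t \<in> D \<and> d * t \<in> D \<and> t \<in> E \<and>
           a * f (b * t) \<le> g t \<and> g t \<le> c * f (d * t)))"

end

theory Submission
  imports Defs
begin

text \<open>
  Throughout, \<open>x\<close> and \<open>y\<close> are unit vectors and \<open>p\<close> is a functional of norm one with \<open>p x = 1\<close>. The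
  number \<open>supp_lambda x y t\<close> measures how far one has to go down from the point \<open>x + t y\<close> of the
  supporting hyperplane at \<open>x\<close>, in the direction \<open>- x\<close>, until the sphere is met.

  For \<open>supp_smoothness_modulus r \<le> smoothness_modulus (2 r)\<close>, let \<open>y\<close> be quasiorthogonal to \<open>x\<close>,
  \<open>0 \<le> t \<le> r\<close>, and let \<open>z = (1 - l) x + t y\<close> be the point where the sphere is met. As \<open>l \<le> t \<le> 1/2\<close>,
  \<open>z = (1/2 - l) x + 1/2 (x + 2 t y)\<close> is a nonnegative combination, so \<open>norm z = 1\<close> forces
  \<open>norm (x + 2 t y) \<ge> 1 + 2 l\<close>, whereas \<open>norm (x - 2 t y) \<ge> 1\<close> because \<open>p y = 0\<close>. The average of
  these two norms thus exceeds 1 by at least \<open>l\<close>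
  (\<open>supp_lambda_le_smoothness_modulus\<close>).

  For \<open>smoothness_modulus \<tau> \<le> supp_smoothness_modulus (2 \<tau>)\<close>, the vector \<open>y\<close> is arbitrary. Split it as
  \<open>y = a x + m v\<close> with \<open>p v = 0\<close>, \<open>norm v = 1\<close> and \<open>0 \<le> m \<le> 2\<close>; then \<open>v\<close> and \<open>- v\<close> are quasiorthogonal
  to \<open>x\<close>. (If \<open>y\<close> is a multiple of \<open>x\<close>, the average of the two norms is 1.) The heart of the proof is
  \<open>norm (x + \<tau> y) \<le> 1 + \<tau> a + m/2 * supp_lambda x v (2 \<tau>)\<close> (\<open>norm_le_tangent_plus_lambda\<close>). Adding
  to it the same estimate for \<open>- y\<close> and \<open>- v\<close> cancels the terms \<open>\<tau> a\<close> and gives the claim.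

  Equivalence at zero follows from the two inequalities by rescaling the argument.

  Supporting functionals are needed at every point of the sphere, both to produce quasiorthogonal
  pairs and to split \<open>y\<close>. They come from the Hahn-Banach theorem, obtained here in the form that a
  pointwise minimal sublinear functional is linear.
\<close>

section \<open>Sublinear functionals and supporting functionals\<close>

definition sublinear :: "('a::real_vector \<Rightarrow> real) \<Rightarrow> bool" where
  "sublinear q \<longleftrightarrow>
     (\<forall>x y. q (x + y) \<le> q x + q y) \<and> (\<forall>c x. 0 \<le> c \<longrightarrow> q (c *\<^sub>R x) = c * q x)"

lemma sublinear_add: "sublinear q \<Longrightarrow> q (x + y) \<le> q x + q y"
  by (simp add: sublinear_def)

lemma sublinear_scale: "sublinear q \<Longrightarrow> 0 \<le> c \<Longrightarrow> q (c *\<^sub>R x) = c * q x"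
  by (simp add: sublinear_def)

lemma sublinear_zero: "sublinear q \<Longrightarrow> q 0 = 0"
  using sublinear_scale[of q 0 0] by simp

lemma sublinear_minus: "sublinear q \<Longrightarrow> - q (- x) \<le> q x"
  using sublinear_add[of q x "- x"] sublinear_zero[of q] by simp

lemma sublinearI:
  assumes add: "\<And>x y. q (x + y) \<le> q x + q y" and zero: "q 0 = 0"
    and scale: "\<And>c x. 0 < c \<Longrightarrow> q (c *\<^sub>R x) \<le> c * q x"
  shows "sublinear q"
  unfolding sublinear_def
proof (intro conjI allI impI)
  fix c :: real and x assume "0 \<le> c"
  show "q (c *\<^sub>R x) = c * q x"
  proof (cases "c = 0")
    case False
    then have c: "0 < c" using \<open>0 \<le> c\<close> by simp
    have "q ((1/c) *\<^sub>R (c *\<^sub>R x)) \<le> (1/c) * q (c *\<^sub>R x)"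
      by (rule scale) (use c in simp)
    then have "c * q x \<le> q (c *\<^sub>R x)" using c by (simp add: field_simps)
    with scale[OF c, of x] show ?thesis by simp
  qed (simp add: zero)
qed (rule add)

text \<open>The largest sublinear functional below \<open>q\<close> whose value at \<open>- y\<close> is at most \<open>- q y\<close>. It replaces
  \<open>q\<close> by a functional that is linear along the line spanned by \<open>y\<close>.\<close>

definition linearize_along :: "('a::real_vector \<Rightarrow> real) \<Rightarrow> 'a \<Rightarrow> 'a \<Rightarrow> real" where
  "linearize_along q y x = (INF t\<in>{0..}. q (x + t *\<^sub>R y) - t * q y)"

lemma linearize_along_bound:
  assumes q: "sublinear q" and t: "0 \<le> t"
  shows "- q (- x) \<le> q (x + t *\<^sub>R y) - t * q y"
  using sublinear_add[OF q, of "x + t *\<^sub>R y" "- x"] sublinear_scale[OF q t, of y] by simp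

lemma linearize_along_le:
  assumes q: "sublinear q" and t: "0 \<le> t"
  shows "linearize_along q y x \<le> q (x + t *\<^sub>R y) - t * q y"
  unfolding linearize_along_def
proof (rule cINF_lower)
  show "bdd_below ((\<lambda>t. q (x + t *\<^sub>R y) - t * q y) ` {0..})"
    by (rule bdd_belowI2) (use linearize_along_bound[OF q] in auto)
qed (use t in simp)

lemma linearize_along_greatest:
  assumes "\<And>t. 0 \<le> t \<Longrightarrow> m \<le> q (x + t *\<^sub>R y) - t * q y"
  shows "m \<le> linearize_along q y x"
  unfolding linearize_along_def by (rule cINF_greatest) (use assms in auto)

lemma sublinear_linearize_along:
  assumes q: "sublinear q"
  shows "sublinear (linearize_along q y)"
proof (rule sublinearI)
  let ?l = "linearize_along q y"
  fix x1 x2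
  have st: "?l (x1 + x2) \<le> (q (x1 + s *\<^sub>R y) - s * q y) + (q (x2 + t *\<^sub>R y) - t * q y)"
    if "0 \<le> s" "0 \<le> t" for s t
  proof -
    have "?l (x1 + x2) \<le> q (x1 + x2 + (s + t) *\<^sub>R y) - (s + t) * q y"
      by (rule linearize_along_le[OF q]) (use that in simp)
    also have "x1 + x2 + (s + t) *\<^sub>R y = (x1 + s *\<^sub>R y) + (x2 + t *\<^sub>R y)"
      by (simp add: algebra_simps)
    finally show ?thesis
      using sublinear_add[OF q, of "x1 + s *\<^sub>R y" "x2 + t *\<^sub>R y"] by (simp add: algebra_simps)
  qed
  \<comment> \<open>The infima over \<open>t\<close> and then over \<open>s\<close> are taken one at a time.\<close>
  have "?l (x1 + x2) - (q (x1 + s *\<^sub>R y) - s * q y) \<le> ?l x2" if "0 \<le> s" for s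
    by (rule linearize_along_greatest) (use st[OF that] in force)
  then have "?l (x1 + x2) - ?l x2 \<le> ?l x1"
    by (intro linearize_along_greatest) force
  then show "?l (x1 + x2) \<le> ?l x1 + ?l x2" by simp
next
  show "linearize_along q y 0 = 0"
    using linearize_along_le[OF q, of 0 y 0] linearize_along_greatest[of 0 q 0 y]
    by (simp add: sublinear_zero[OF q] sublinear_scale[OF q])
next
  fix c :: real and x assume c: "0 < c"
  have "linearize_along q y (c *\<^sub>R x) / c \<le> linearize_along q y x"
  proof (rule linearize_along_greatest)
    fix t :: real assume t: "0 \<le> t"
    have "linearize_along q y (c *\<^sub>R x) \<le> q (c *\<^sub>R x + (c * t) *\<^sub>R y) - (c * t) * q y"
      by (rule linearize_along_le[OF q]) (use c t in simp)
    also have "c *\<^sub>R x + (c * t) *\<^sub>R y = c *\<^sub>R (x + t *\<^sub>R y)"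
      by (simp add: algebra_simps)
    also have "q (c *\<^sub>R (x + t *\<^sub>R y)) = c * q (x + t *\<^sub>R y)"
      using c by (intro sublinear_scale[OF q]) simp
    finally show "linearize_along q y (c *\<^sub>R x) / c \<le> q (x + t *\<^sub>R y) - t * q y"
      using c by (simp add: field_simps)
  qed
  then show "linearize_along q y (c *\<^sub>R x) \<le> c * linearize_along q y x"
    using c by (simp add: field_simps)
qed

text \<open>By minimality \<open>q\<close> coincides with its linearization along every \<open>y\<close>. The parameter \<open>t = 1\<close> in the
  infimum then gives \<open>q x \<le> q (x + y) - q y\<close>, the converse of subadditivity.\<close>

lemma minimal_sublinear_imp_linear:
  assumes q: "sublinear q"
    and min: "\<And>q'. sublinear q' \<Longrightarrow> (\<And>x. q' x \<le> q x) \<Longrightarrow> q' = q"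
  shows "linear q"
proof -
  have eq: "linearize_along q y = q" for y
    by (rule min[OF sublinear_linearize_along[OF q]]) (use linearize_along_le[OF q, of 0] in simp)
  have add: "q (x + y) = q x + q y" for x y
    using linearize_along_le[OF q, of 1 y x] sublinear_add[OF q, of x y] by (simp add: eq)
  have neg: "q (- x) = - q x" for x
    using add[of x "- x"] sublinear_zero[OF q] by simp
  have "q (c *\<^sub>R x) = c * q x" for c x
  proof (cases "0 \<le> c")
    case False
    then show ?thesis using neg[of "(- c) *\<^sub>R x"] sublinear_scale[OF q, of "- c" x] by simp
  qed (rule sublinear_scale[OF q])
  with add show ?thesis by (intro linearI) auto
qed

text \<open>Zorn's lemma for the reversed pointwise order: the pointwise infimum of a chain is finite, since
  each member \<open>q\<close> satisfies \<open>q x \<ge> - q (- x) \<ge> - q0 (- x)\<close>, and it is sublinear because any two members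
  are comparable.\<close>

lemma minimal_sublinear_below:
  fixes q0 :: "'a::real_vector \<Rightarrow> real"
  assumes q0: "sublinear q0"
  obtains q where "sublinear q" "\<And>x. q x \<le> q0 x"
    "\<And>q'. sublinear q' \<Longrightarrow> (\<And>x. q' x \<le> q x) \<Longrightarrow> q' = q"
proof -
  define A where "A = {q. sublinear q \<and> q \<le> q0}"
  let ?P = "\<lambda>f g :: 'a \<Rightarrow> real. g \<le> f"
  have "\<exists>m\<in>A. \<forall>a\<in>A. ?P m a \<longrightarrow> a = m"
  proof (rule predicate_Zorn)
    show "partial_order_on A (relation_of ?P A)"
      by (rule partial_order_on_relation_ofI) auto
  next
    fix C assume "C \<in> Chains (relation_of ?P A)"
    then have CA: "C \<subseteq> A" and chain: "\<And>f g. f \<in> C \<Longrightarrow> g \<in> C \<Longrightarrow> f \<le> g \<or> g \<le> f"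
      unfolding Chains_def relation_of_def by auto
    show "\<exists>u\<in>A. \<forall>a\<in>C. u \<le> a"
    proof (cases "C = {}")
      case True
      then show ?thesis using q0 by (auto simp: A_def)
    next
      case False
      define u where "u x = (INF q\<in>C. q x)" for x
      have sub: "sublinear q" "q x \<le> q0 x" if "q \<in> C" for q x
        using that CA by (auto simp: A_def le_fun_def)
      have "- q0 (- x) \<le> q x" if "q \<in> C" for q x
        using sublinear_minus[OF sub(1)[OF that], of x] sub(2)[OF that, of "- x"] by simp
      then have "bdd_below ((\<lambda>q. q x) ` C)" for x by (rule bdd_belowI2)
      then have lower: "u x \<le> q x" if "q \<in> C" for q x
        unfolding u_def using that by (intro cINF_lower)
      have greatest: "m \<le> u x" if "\<And>q. q \<in> C \<Longrightarrow> m \<le> q x" for m x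
        unfolding u_def by (rule cINF_greatest[OF False]) (use that in auto)
      have "sublinear u"
      proof (rule sublinearI)
        fix x y
        have fg: "u (x + y) \<le> f x + g y" if f: "f \<in> C" and g: "g \<in> C" for f g
          using chain[OF f g]
        proof
          assume "f \<le> g"
          then show ?thesis
            using lower[OF f, of "x + y"] sublinear_add[OF sub(1)[OF f], of x y]
            by (auto simp: le_fun_def intro: order_trans add_left_mono)
        next
          assume "g \<le> f"
          then show ?thesis
            using lower[OF g, of "x + y"] sublinear_add[OF sub(1)[OF g], of x y]
            by (auto simp: le_fun_def intro: order_trans add_right_mono)
        qed
        have "u (x + y) - f x \<le> u y" if "f \<in> C" for f
          by (rule greatest) (use fg[OF that] in force)
        then have "u (x + y) - u y \<le> u x"
          by (intro greatest) force
        then show "u (x + y) \<le> u x + u y" by simp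
      next
        obtain f where f: "f \<in> C" using False by blast
        have "u 0 \<le> 0" using lower[OF f, of 0] sublinear_zero[OF sub(1)[OF f]] by simp
        moreover have "0 \<le> u 0" by (rule greatest) (simp add: sublinear_zero[OF sub(1)])
        ultimately show "u 0 = 0" by simp
      next
        fix c :: real and x assume c: "0 < c"
        have "u (c *\<^sub>R x) / c \<le> u x"
        proof (rule greatest)
          fix q assume "q \<in> C"
          then show "u (c *\<^sub>R x) / c \<le> q x"
            using lower[of q "c *\<^sub>R x"] sublinear_scale[OF sub(1), of q c x] c
            by (simp add: field_simps)
        qed
        then show "u (c *\<^sub>R x) \<le> c * u x" using c by (simp add: field_simps)
      qed
      moreover have "u \<le> q0"
      proof (rule le_funI)
        fix x
        obtain f where "f \<in> C" using False by blast
        then show "u x \<le> q0 x" using lower[of f x] sub(2)[of f x] by simp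
      qed
      ultimately show ?thesis using lower by (auto simp: A_def le_fun_def)
    qed
  qed
  then obtain m where m: "m \<in> A" "\<And>a. a \<in> A \<Longrightarrow> a \<le> m \<Longrightarrow> a = m" by blast
  show thesis
  proof
    show "sublinear m" "m x \<le> q0 x" for x using m(1) by (auto simp: A_def le_fun_def)
    show "q' = m" if "sublinear q'" "\<And>x. q' x \<le> m x" for q'
      using that m(1) by (intro m(2)) (auto simp: A_def le_fun_def intro: order_trans)
  qed
qed

text \<open>A minimal sublinear functional below the norm need not support the ball at \<open>x\<close>. Starting from the
  norm linearized along \<open>x\<close>, which takes a value at most \<open>- 1\<close> at \<open>- x\<close>, forces \<open>p x = 1\<close>.\<close>

lemma supporting_functional_exists:
  fixes x :: "'a::real_normed_vector"
  assumes x: "norm x = 1"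
  obtains p :: "'a \<Rightarrow>\<^sub>L real" where "norm p = 1" "blinfun_apply p x = 1"
proof -
  have N: "sublinear (norm :: 'a \<Rightarrow> real)"
    by (simp add: sublinear_def norm_triangle_ineq)
  let ?q = "linearize_along (norm :: 'a \<Rightarrow> real) x"
  obtain p where p: "sublinear p" "\<And>z. p z \<le> ?q z"
    "\<And>q'. sublinear q' \<Longrightarrow> (\<And>z. q' z \<le> p z) \<Longrightarrow> q' = p"
    using minimal_sublinear_below[OF sublinear_linearize_along[OF N, of x]] by blast
  have lin: "linear p" by (rule minimal_sublinear_imp_linear[OF p(1) p(3)])
  have le: "p z \<le> norm z" for z
    using p(2)[of z] linearize_along_le[OF N, of 0 x z] by simp
  have abs: "\<bar>p z\<bar> \<le> norm z" for z
    using le[of z] le[of "- z"] linear_neg[OF lin, of z] by simp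
  have bl: "bounded_linear p"
    using abs by (intro bounded_linear_intro[of p 1])
      (auto simp: linear_add[OF lin] linear_scale[OF lin])
  have "p (- x) \<le> - 1"
    using p(2)[of "- x"] linearize_along_le[OF N, of 1 x "- x"] x by simp
  then have px: "p x = 1" using linear_neg[OF lin, of x] le[of x] x by simp
  let ?p = "Blinfun p"
  have app: "blinfun_apply ?p = p" by (rule bounded_linear_Blinfun_apply[OF bl])
  have "norm ?p \<le> 1" by (rule norm_blinfun_bound) (use abs app in auto)
  moreover have "1 \<le> norm ?p" using norm_blinfun[of ?p x] by (simp add: app px x)
  ultimately show thesis using that[of ?p] px by (simp add: app)
qed

lemma functional_norm_one_le:
  fixes p :: "'a::real_normed_vector \<Rightarrow>\<^sub>L real"
  assumes "norm p = 1"
  shows "\<bar>blinfun_apply p z\<bar> \<le> norm z"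
  using norm_blinfun[of p z] assms by simp

section \<open>The distance to the sphere along a supporting direction\<close>

text \<open>The function \<open>l \<mapsto> norm (x + t y - l x)\<close> is at least \<open>1 - l\<close>, by the supporting functional, hence
  at least 1 for \<open>l \<le> 0\<close> and different from 1 for \<open>l < 0\<close>. At \<open>l = t\<close> its argument is a convex
  combination of \<open>x\<close> and \<open>y\<close>, so there it is at most 1. Hence it takes the value 1 in \<open>[0, t]\<close>, and
  closedness of the level set provides the least such \<open>l\<close>.\<close>

lemma supp_lambda_root:
  fixes x y :: "'a::real_normed_vector"
  assumes x: "norm x = 1" and y: "norm y = 1" and qo: "quasiorthogonal y x"
    and t: "0 \<le> t" "t \<le> 1"
  defines "l \<equiv> supp_lambda x y t"
  shows "norm ((1 - l) *\<^sub>R x + t *\<^sub>R y) = 1" "0 \<le> l" "l \<le> t"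
proof -
  let ?f = "\<lambda>l. norm (x + t *\<^sub>R y - l *\<^sub>R x)"
  let ?S = "{l. ?f l = 1}"
  obtain p :: "'a \<Rightarrow>\<^sub>L real" where p: "norm p = 1" "blinfun_apply p x = 1" "blinfun_apply p y = 0"
    using qo x unfolding quasiorthogonal_def by auto
  have low: "1 - l \<le> ?f l" for l
    using functional_norm_one_le[OF p(1), of "x + t *\<^sub>R y - l *\<^sub>R x"]
    by (simp add: blinfun.add_right blinfun.diff_right blinfun.scaleR_right p)
  have cont: "continuous_on A ?f" for A by (intro continuous_intros)
  have up: "?f t \<le> 1"
  proof -
    have "?f t = norm ((1 - t) *\<^sub>R x + t *\<^sub>R y)" by (simp add: algebra_simps)
    also have "\<dots> \<le> 1" using norm_triangle_ineq[of "(1 - t) *\<^sub>R x" "t *\<^sub>R y"] x y t by simp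
    finally show ?thesis .
  qed
  obtain l0 where l0: "0 \<le> l0" "l0 \<le> t" "?f l0 = 1"
    using IVT2'[of ?f t 1 0] up low[of 0] t cont by auto
  have ge0: "0 \<le> l" if "l \<in> ?S" for l using low[of l] that by simp
  then have bdd: "bdd_below ?S" by (intro bdd_belowI[of _ 0])
  have "closed ?S" by (intro closed_Collect_eq continuous_intros)
  then have Inf: "Inf ?S \<in> ?S"
    using l0(3) bdd by (intro closed_contains_Inf) auto
  have l: "l = Inf ?S"
    unfolding l_def supp_lambda_def
    by (rule Least_equality) (use Inf bdd in \<open>auto intro: cInf_lower\<close>)
  show "norm ((1 - l) *\<^sub>R x + t *\<^sub>R y) = 1" using Inf l by (simp add: algebra_simps)
  show "0 \<le> l" using ge0[OF Inf] l by simp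
  have "Inf ?S \<le> l0" using l0(3) bdd by (intro cInf_lower) auto
  then show "l \<le> t" using l l0(2) by simp
qed

lemma supp_lambda_le_modulus:
  fixes x y :: "'a::real_normed_vector"
  assumes "norm x = 1" "norm y = 1" "quasiorthogonal y x" "0 \<le> t" "t \<le> r" "r \<le> 1"
  shows "supp_lambda x y t \<le> supp_smoothness_modulus TYPE('a) r"
  unfolding supp_smoothness_modulus_def
proof (rule cSup_upper)
  show "bdd_above {supp_lambda x y t |(x :: 'a) y t.
      norm x = 1 \<and> norm y = 1 \<and> quasiorthogonal y x \<and> 0 \<le> t \<and> t \<le> r}"
    using supp_lambda_root(3) assms(6) by (force intro!: bdd_aboveI[of _ 1])
qed (use assms in blast)

lemma smoothness_modulus_ge:
  fixes x y :: "'a::real_normed_vector"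
  assumes "norm x = 1" "norm y = t"
  shows "norm (x + y) / 2 + norm (x - y) / 2 - 1 \<le> smoothness_modulus TYPE('a) t"
  unfolding smoothness_modulus_def
proof (rule cSup_upper)
  have "norm (x + y) / 2 + norm (x - y) / 2 - 1 \<le> t" if "norm x = 1" "norm y = t" for x y :: 'a
    using norm_triangle_ineq[of x y] norm_triangle_ineq4[of x y] that by simp
  then show "bdd_above {norm (x + y) / 2 + norm (x - y) / 2 - 1 |(x :: 'a) y.
      norm x = 1 \<and> norm y = t}"
    by (force intro!: bdd_aboveI[of _ t])
qed (use assms in blast)

lemma norm_add_diff_ge: "2 * norm x \<le> norm (x + y) + norm (x - y)"
  for x y :: "'a::real_normed_vector"
  using norm_triangle_ineq[of "x + y" "x - y"] by (simp flip: scaleR_2)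

text \<open>As a function of \<open>s\<close> the left-hand side is convex and even.\<close>

lemma norm_add_diff_mono:
  fixes x y :: "'a::real_normed_vector"
  assumes "0 \<le> s" "s \<le> t"
  shows "norm (x + s *\<^sub>R y) + norm (x - s *\<^sub>R y) \<le> norm (x + t *\<^sub>R y) + norm (x - t *\<^sub>R y)"
proof (cases "t = 0")
  case False
  then have t: "0 < t" using assms by simp
  define c where "c = s / t"
  have c: "0 \<le> c" "c \<le> 1" "s = c * t" using assms t by (auto simp: c_def)
  have "x + s *\<^sub>R y = (1 - c) *\<^sub>R x + c *\<^sub>R (x + t *\<^sub>R y)"
    "x - s *\<^sub>R y = (1 - c) *\<^sub>R x + c *\<^sub>R (x - t *\<^sub>R y)"
    by (simp_all add: c(3) algebra_simps)
  then have "norm (x + s *\<^sub>R y) \<le> (1 - c) * norm x + c * norm (x + t *\<^sub>R y)"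
    "norm (x - s *\<^sub>R y) \<le> (1 - c) * norm x + c * norm (x - t *\<^sub>R y)"
    using c norm_triangle_ineq[of "(1 - c) *\<^sub>R x" "c *\<^sub>R (x + t *\<^sub>R y)"]
      norm_triangle_ineq[of "(1 - c) *\<^sub>R x" "c *\<^sub>R (x - t *\<^sub>R y)"] by simp_all
  moreover have "(1 - c) * (2 * norm x) \<le> (1 - c) * (norm (x + t *\<^sub>R y) + norm (x - t *\<^sub>R y))"
    using c norm_add_diff_ge[of x "t *\<^sub>R y"] by (intro mult_left_mono) auto
  ultimately show ?thesis by (simp add: algebra_simps)
qed (use assms in simp)

section \<open>Comparison of the two moduli\<close>

lemma supp_lambda_le_smoothness_modulus:
  fixes x y :: "'a::real_normed_vector"
  assumes x: "norm x = 1" and y: "norm y = 1" and qo: "quasiorthogonal y x"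
    and t: "0 \<le> t" "t \<le> r" "r \<le> 1/2"
  shows "supp_lambda x y t \<le> smoothness_modulus TYPE('a) (2 * r)"
proof -
  obtain p :: "'a \<Rightarrow>\<^sub>L real" where p: "norm p = 1" "blinfun_apply p x = 1" "blinfun_apply p y = 0"
    using qo x unfolding quasiorthogonal_def by auto
  define l where "l = supp_lambda x y t"
  have l: "norm ((1 - l) *\<^sub>R x + t *\<^sub>R y) = 1" "0 \<le> l" "l \<le> 1/2"
    using supp_lambda_root[OF x y qo, of t] t by (auto simp: l_def)
  \<comment> \<open>Since \<open>l \<le> 1/2\<close>, the point on the sphere is a nonnegative combination of \<open>x\<close> and \<open>x + 2 t y\<close>.\<close>
  have "(1 - l) *\<^sub>R x + t *\<^sub>R y = (1/2 - l) *\<^sub>R x + (1/2) *\<^sub>R (x + (2 * t) *\<^sub>R y)"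
    by (simp add: algebra_simps flip: scaleR_add_left)
  then have "1 \<le> (1/2 - l) + norm (x + (2 * t) *\<^sub>R y) / 2"
    using norm_triangle_ineq[of "(1/2 - l) *\<^sub>R x" "(1/2) *\<^sub>R (x + (2 * t) *\<^sub>R y)"] l x by simp
  moreover have "1 \<le> norm (x - (2 * t) *\<^sub>R y)"
    using functional_norm_one_le[OF p(1), of "x - (2 * t) *\<^sub>R y"]
    by (simp add: blinfun.diff_right blinfun.scaleR_right p)
  ultimately have "l \<le> norm (x + (2 * t) *\<^sub>R y) / 2 + norm (x - (2 * t) *\<^sub>R y) / 2 - 1"
    by simp
  also have "\<dots> \<le> norm (x + (2 * r) *\<^sub>R y) / 2 + norm (x - (2 * r) *\<^sub>R y) / 2 - 1"
    using norm_add_diff_mono[of "2 * t" "2 * r" x y] t by simp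
  also have "\<dots> \<le> smoothness_modulus TYPE('a) (2 * r)"
    by (rule smoothness_modulus_ge) (use x y t in auto)
  finally show ?thesis by (simp add: l_def)
qed

text \<open>Let \<open>N = norm (x + \<tau> y)\<close> and \<open>e = (1 - L) x + 2 \<tau> v\<close>, a unit vector. The vector
  \<open>x + \<tau> y = (1 + \<tau> a) x + \<tau> m v\<close> lies on the line through \<open>\<tau> m v\<close> parallel to \<open>x\<close>. On the same line
  lies \<open>m/2 e + (N - m/2) x\<close>, whose norm is at most \<open>N\<close> because \<open>m \<le> 2 N\<close>; its \<open>x\<close>-coordinate is
  \<open>N - m/2 L\<close>. If the claim failed, \<open>x + \<tau> y\<close> would lie strictly between that point and the point
  \<open>\<tau> m v\<close> of norm less than \<open>N\<close>, so that by convexity its own norm would be less than \<open>N\<close>.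

  The bound \<open>m \<le> 2 N\<close> makes the argument \<open>2 \<tau>\<close> suffice. The obvious \<open>m \<le> 1 + \<bar>a\<bar>\<close> together with
  \<open>N \<ge> 1 + \<tau> a\<close> would not give it for \<open>a\<close> near \<open>- 1\<close>, so \<open>m v\<close> is expressed through \<open>y\<close> and
  \<open>x + \<tau> y\<close> instead of \<open>y\<close> and \<open>x\<close>.\<close>

lemma norm_le_tangent_plus_lambda:
  fixes x y v :: "'a::real_normed_vector" and p :: "'a \<Rightarrow>\<^sub>L real"
  assumes x: "norm x = 1" and y: "norm y = 1" and v: "norm v = 1"
    and p: "norm p = 1" "blinfun_apply p x = 1"
    and decomp: "y = a *\<^sub>R x + m *\<^sub>R v" and pv: "blinfun_apply p v = 0"
    and m: "0 \<le> m" and \<tau>: "0 \<le> \<tau>" "2 * \<tau> < 1"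
    and L: "norm ((1 - L) *\<^sub>R x + (2 * \<tau>) *\<^sub>R v) = 1"
  shows "norm (x + \<tau> *\<^sub>R y) \<le> 1 + \<tau> * a + m / 2 * L"
proof (rule ccontr)
  assume neg: "\<not> ?thesis"
  define N where "N = norm (x + \<tau> *\<^sub>R y)"
  define A where "A = 1 + \<tau> * a"
  define C where "C = N - m / 2 * L"
  have py: "blinfun_apply p y = a"
    by (simp add: decomp blinfun.add_right blinfun.scaleR_right p pv)
  have a: "\<bar>a\<bar> \<le> 1" using functional_norm_one_le[OF p(1), of y] by (simp add: py y)
  have "\<bar>\<tau> * a\<bar> \<le> \<tau>" using a \<tau>(1) by (simp add: abs_mult mult_left_le)
  then have A0: "0 < A" using \<tau> by (simp add: A_def)
  have "\<bar>A\<bar> \<le> N"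
    using functional_norm_one_le[OF p(1), of "x + \<tau> *\<^sub>R y"]
    by (simp add: A_def N_def py p blinfun.add_right blinfun.scaleR_right)
  then have AN: "A \<le> N" and N0: "0 < N" using A0 by auto
  have AC: "A < C" using neg by (simp add: A_def C_def N_def)
  have mN: "m \<le> 2 * N"
  proof -
    have "m *\<^sub>R v = A *\<^sub>R y - a *\<^sub>R (x + \<tau> *\<^sub>R y)"
      unfolding A_def using decomp by (simp add: algebra_simps)
    then have "norm (m *\<^sub>R v) \<le> norm (A *\<^sub>R y) + norm (a *\<^sub>R (x + \<tau> *\<^sub>R y))"
      by (simp only: norm_triangle_ineq4)
    then have "m \<le> A + \<bar>a\<bar> * N"
      using v y m A0 by (simp add: N_def)
    also have "\<dots> \<le> N + 1 * N" using AN a N0 by (intro add_mono mult_right_mono) auto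
    finally show ?thesis by simp
  qed
  have "C *\<^sub>R x + (\<tau> * m) *\<^sub>R v =
      (m / 2) *\<^sub>R ((1 - L) *\<^sub>R x + (2 * \<tau>) *\<^sub>R v) + (N - m / 2) *\<^sub>R x"
    by (simp add: C_def algebra_simps)
  then have high: "norm (C *\<^sub>R x + (\<tau> * m) *\<^sub>R v) \<le> N"
    using norm_triangle_ineq[of "(m / 2) *\<^sub>R ((1 - L) *\<^sub>R x + (2 * \<tau>) *\<^sub>R v)" "(N - m / 2) *\<^sub>R x"]
      L x m mN by simp
  have "\<tau> * m \<le> \<tau> * (2 * N)" using mN \<tau> by (intro mult_left_mono) auto
  also have "\<dots> < N" using \<tau> N0 by simp
  finally have low: "norm ((\<tau> * m) *\<^sub>R v) < N" using \<tau> m v by simp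
  define c where "c = A / C"
  have c: "0 \<le> c" "0 < 1 - c" "c * C = A" using A0 AC by (auto simp: c_def)
  have "x + \<tau> *\<^sub>R y = A *\<^sub>R x + (\<tau> * m) *\<^sub>R v"
    by (simp add: A_def decomp algebra_simps)
  also have "\<dots> = c *\<^sub>R (C *\<^sub>R x + (\<tau> * m) *\<^sub>R v) + (1 - c) *\<^sub>R ((\<tau> * m) *\<^sub>R v)"
    by (simp add: algebra_simps flip: c(3))
  finally have "N \<le> norm (c *\<^sub>R (C *\<^sub>R x + (\<tau> * m) *\<^sub>R v)) + norm ((1 - c) *\<^sub>R ((\<tau> * m) *\<^sub>R v))"
    unfolding N_def by (simp only: norm_triangle_ineq)
  also have "\<dots> = c * norm (C *\<^sub>R x + (\<tau> * m) *\<^sub>R v) + (1 - c) * norm ((\<tau> * m) *\<^sub>R v)"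
    using c(1,2) by (simp only: norm_scaleR abs_of_nonneg abs_of_pos)
  also have "\<dots> < c * N + (1 - c) * N"
    using high low c by (intro add_le_less_mono mult_left_mono mult_strict_left_mono) auto
  finally show False by (simp add: algebra_simps)
qed

text \<open>Project a vector outside the line of \<open>x\<close> onto the kernel of a functional supporting the ball
  at \<open>x\<close>.\<close>

lemma quasiorthogonal_pair_exists:
  assumes "\<exists>B :: 'a::real_normed_vector set. independent B \<and> card B = 2"
  obtains x y :: "'a::real_normed_vector" where "norm x = 1" "norm y = 1" "quasiorthogonal y x"
proof -
  obtain b1 b2 :: 'a where ind: "independent {b1, b2}" and ne: "b1 \<noteq> b2"
    using assms by (auto simp: card_2_iff)
  have b1: "b1 \<noteq> 0" using ind dependent_zero[of "{b1, b2}"] by auto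
  define x where "x = b1 /\<^sub>R norm b1"
  have x: "norm x = 1" using b1 by (simp add: x_def)
  obtain p :: "'a \<Rightarrow>\<^sub>L real" where p: "norm p = 1" "blinfun_apply p x = 1"
    using supporting_functional_exists[OF x] .
  define z where "z = b2 - blinfun_apply p b2 *\<^sub>R x"
  have "z \<noteq> 0"
  proof
    assume "z = 0"
    then have "b2 = (blinfun_apply p b2 / norm b1) *\<^sub>R b1"
      by (simp add: z_def x_def divide_inverse)
    then have "b2 \<in> span {b1}" by (metis insertI1 span_base span_scale)
    moreover have "independent (insert b2 {b1})" using ind by (simp add: insert_commute)
    ultimately show False using ne by (simp add: independent_insert)
  qed
  define y where "y = z /\<^sub>R norm z"
  have "blinfun_apply p y = 0"
    by (simp add: y_def z_def blinfun.scaleR_right blinfun.diff_right p)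
  then have "quasiorthogonal y x"
    using p x unfolding quasiorthogonal_def by (intro conjI exI[of _ p]) auto
  moreover have "norm y = 1" using \<open>z \<noteq> 0\<close> by (simp add: y_def)
  ultimately show thesis using that x by blast
qed

lemma supp_smoothness_modulus_nonneg:
  assumes dim: "\<exists>B :: 'a::real_normed_vector set. independent B \<and> card B = 2"
    and r: "0 \<le> r" "r \<le> 1"
  shows "0 \<le> supp_smoothness_modulus TYPE('a) r"
proof -
  obtain x y :: 'a where xy: "norm x = 1" "norm y = 1" "quasiorthogonal y x"
    using quasiorthogonal_pair_exists[OF dim] .
  show ?thesis
    using supp_lambda_root(2)[OF xy, of 0] supp_lambda_le_modulus[OF xy, of 0 r] r by simp
qed

text \<open>Estimate both norms by \<open>norm_le_tangent_plus_lambda\<close> for the decompositions of \<open>y\<close> and \<open>- y\<close> along \<open>x\<close>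
  and the kernel of a functional supporting the ball at \<open>x\<close>. The linear terms \<open>\<plusminus> \<tau> a\<close> cancel, and
  the transverse coefficient \<open>m = norm (y - a x)\<close> is at most 2, so what remains is at most the
  supremum.\<close>

lemma smoothness_le_supp_smoothness_modulus:
  fixes x y :: "'a::real_normed_vector"
  assumes dim: "\<exists>B :: 'a set. independent B \<and> card B = 2"
    and x: "norm x = 1" and y: "norm y = 1" and \<tau>: "0 \<le> \<tau>" "2 * \<tau> < 1"
  shows "norm (x + \<tau> *\<^sub>R y) / 2 + norm (x - \<tau> *\<^sub>R y) / 2 - 1
      \<le> supp_smoothness_modulus TYPE('a) (2 * \<tau>)"
proof -
  let ?M = "supp_smoothness_modulus TYPE('a) (2 * \<tau>)"
  obtain p :: "'a \<Rightarrow>\<^sub>L real" where p: "norm p = 1" "blinfun_apply p x = 1"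
    using supporting_functional_exists[OF x] .
  have M0: "0 \<le> ?M" using \<tau> by (intro supp_smoothness_modulus_nonneg[OF dim]) auto
  define a where "a = blinfun_apply p y"
  define m where "m = norm (y - a *\<^sub>R x)"
  have a: "\<bar>a\<bar> \<le> 1" using functional_norm_one_le[OF p(1), of y] y by (simp add: a_def)
  have m2: "m \<le> 2" using norm_triangle_ineq4[of y "a *\<^sub>R x"] a x y by (simp add: m_def)
  show ?thesis
  proof (cases "m = 0")
    case True
    then have "y = a *\<^sub>R x" by (simp add: m_def)
    then have "x + \<tau> *\<^sub>R y = (1 + \<tau> * a) *\<^sub>R x" "x - \<tau> *\<^sub>R y = (1 - \<tau> * a) *\<^sub>R x"
      by (simp_all add: algebra_simps)
    moreover have "\<bar>\<tau> * a\<bar> \<le> \<tau>" using a \<tau>(1) by (simp add: abs_mult mult_left_le)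
    ultimately have "norm (x + \<tau> *\<^sub>R y) = 1 + \<tau> * a" "norm (x - \<tau> *\<^sub>R y) = 1 - \<tau> * a"
      using x \<tau> by simp_all
    then have "norm (x + \<tau> *\<^sub>R y) / 2 + norm (x - \<tau> *\<^sub>R y) / 2 - 1 = 0"
      by (simp add: field_simps)
    then show ?thesis using M0 by simp
  next
    case False
    then have m0: "0 < m" by (simp add: m_def)
    define v where "v = (y - a *\<^sub>R x) /\<^sub>R m"
    have v: "norm v = 1" using m0 by (simp add: v_def flip: m_def)
    have pv: "blinfun_apply p v = 0"
      by (simp add: v_def blinfun.scaleR_right blinfun.diff_right p a_def)
    have yv: "y = a *\<^sub>R x + m *\<^sub>R v" using m0 by (simp add: v_def)
    have qo: "quasiorthogonal v x" "quasiorthogonal (- v) x"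
      unfolding quasiorthogonal_def using p pv x
      by (auto intro!: exI[of _ p] simp: blinfun.minus_right)
    define L1 where "L1 = supp_lambda x v (2 * \<tau>)"
    define L2 where "L2 = supp_lambda x (- v) (2 * \<tau>)"
    have 1: "norm (x + \<tau> *\<^sub>R y) \<le> 1 + \<tau> * a + m / 2 * L1"
      using supp_lambda_root(1)[OF x v qo(1), of "2 * \<tau>"] m0 \<tau>
      by (intro norm_le_tangent_plus_lambda[OF x y v p yv pv]) (auto simp: L1_def)
    have 2: "norm (x + \<tau> *\<^sub>R (- y)) \<le> 1 + \<tau> * (- a) + m / 2 * L2"
    proof (rule norm_le_tangent_plus_lambda[OF x _ _ p])
      show "- y = (- a) *\<^sub>R x + m *\<^sub>R (- v)" by (subst yv) simp
      show "norm ((1 - L2) *\<^sub>R x + (2 * \<tau>) *\<^sub>R (- v)) = 1"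
        unfolding L2_def using \<tau> v by (intro supp_lambda_root(1)[OF x _ qo(2)]) auto
    qed (use m0 \<tau> v y pv in \<open>auto simp: blinfun.minus_right\<close>)
    have "L1 \<le> ?M" "L2 \<le> ?M"
      unfolding L1_def L2_def using x v qo \<tau> by (auto intro!: supp_lambda_le_modulus)
    then have "m / 2 * L1 \<le> m / 2 * ?M" "m / 2 * L2 \<le> m / 2 * ?M"
      using m0 by (auto intro!: mult_left_mono)
    moreover have "m / 2 * ?M \<le> 1 * ?M" using M0 m2 by (intro mult_right_mono) auto
    ultimately show ?thesis using 1 2 by simp
  qed
qed

theorem theorem2:
  assumes dim_ge_2: "\<exists>B :: 'a::banach set. independent B \<and> card B = 2"
  shows "equivalent_at_zero {0..1} (supp_smoothness_modulus TYPE('a))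
                            {0..} (smoothness_modulus TYPE('a)) \<and>
         (\<forall>r\<in>{0..1/2}.
            smoothness_modulus TYPE('a) (r / 2) \<le> supp_smoothness_modulus TYPE('a) r \<and>
            supp_smoothness_modulus TYPE('a) r \<le> smoothness_modulus TYPE('a) (2 * r))"
proof -
  let ?L = "supp_smoothness_modulus TYPE('a)" and ?R = "smoothness_modulus TYPE('a)"
  obtain x0 y0 :: 'a where xy0: "norm x0 = 1" "norm y0 = 1" "quasiorthogonal y0 x0"
    using quasiorthogonal_pair_exists[OF dim_ge_2] .
  have L0: "0 \<le> ?L r" if "0 \<le> r" "r \<le> 1" for r
    using that by (rule supp_smoothness_modulus_nonneg[OF dim_ge_2])
  have R0: "0 \<le> ?R t" if "0 \<le> t" for t
    using smoothness_modulus_ge[OF xy0(1), of "t *\<^sub>R y0" t] norm_add_diff_ge[of x0 "t *\<^sub>R y0"]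
      xy0 that by simp
  have upper: "?L r \<le> ?R (2 * r)" if r: "0 \<le> r" "r \<le> 1/2" for r
    unfolding supp_smoothness_modulus_def
  proof (rule cSup_least)
    show "{supp_lambda x y t |(x :: 'a) y t.
        norm x = 1 \<and> norm y = 1 \<and> quasiorthogonal y x \<and> 0 \<le> t \<and> t \<le> r} \<noteq> {}"
      using xy0 r by blast
  qed (use supp_lambda_le_smoothness_modulus r in blast)
  have lower: "?R \<tau> \<le> ?L (2 * \<tau>)" if \<tau>: "0 \<le> \<tau>" "\<tau> \<le> 1/4" for \<tau>
    unfolding smoothness_modulus_def
  proof (rule cSup_least)
    have "norm (\<tau> *\<^sub>R y0) = \<tau>" using xy0 \<tau> by simp
    then show "{norm (x + y) / 2 + norm (x - y) / 2 - 1 |(x :: 'a) y.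
        norm x = 1 \<and> norm y = \<tau>} \<noteq> {}"
      using xy0(1) by blast
  next
    fix s assume "s \<in> {norm (x + y) / 2 + norm (x - y) / 2 - 1 |(x :: 'a) y.
        norm x = 1 \<and> norm y = \<tau>}"
    then obtain x w :: 'a where s: "s = norm (x + w) / 2 + norm (x - w) / 2 - 1"
      and x: "norm x = 1" and w: "norm w = \<tau>" by blast
    obtain y where y: "norm y = 1" "w = \<tau> *\<^sub>R y"
    proof (cases "\<tau> = 0")
      case True
      then show thesis using that[of x] x w by simp
    next
      case False
      then show thesis using that[of "w /\<^sub>R \<tau>"] w \<tau> by simp
    qed
    show "s \<le> ?L (2 * \<tau>)"
      using smoothness_le_supp_smoothness_modulus[OF dim_ge_2 x y(1), of \<tau>] \<tau> s y(2) by simp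
  qed
  have "equivalent_at_zero {0..1} ?L {0..} ?R"
    unfolding equivalent_at_zero_def
  proof (intro conjI)
    show "\<exists>a b c d e :: real. 0 < a \<and> 0 < b \<and> 0 < c \<and> 0 < d \<and> 0 < e \<and>
        (\<forall>t\<in>{0..e}. b * t \<in> {0..1} \<and> d * t \<in> {0..1} \<and> t \<in> {0..} \<and>
           a * ?L (b * t) \<le> ?R t \<and> ?R t \<le> c * ?L (d * t))"
    proof -
      have "\<forall>t\<in>{0..1/4}. 1/2 * t \<in> {0..1} \<and> 2 * t \<in> {0..1} \<and> t \<in> {0..} \<and>
          1 * ?L (1/2 * t) \<le> ?R t \<and> ?R t \<le> 1 * ?L (2 * t)"
      proof
        fix t :: real assume t: "t \<in> {0..1/4}"
        show "1/2 * t \<in> {0..1} \<and> 2 * t \<in> {0..1} \<and> t \<in> {0..} \<and>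
            1 * ?L (1/2 * t) \<le> ?R t \<and> ?R t \<le> 1 * ?L (2 * t)"
          using upper[of "1/2 * t"] lower[of t] t by simp
      qed
      moreover have "0 < (1::real)" "0 < (1/2::real)" "0 < (2::real)" "0 < (1/4::real)" by simp_all
      ultimately show ?thesis by blast
    qed
  qed (use L0 R0 in auto)
  moreover have "?R (r / 2) \<le> ?L r" "?L r \<le> ?R (2 * r)" if "r \<in> {0..1/2}" for r
    using upper[of r] lower[of "r / 2"] that by auto
  ultimately show ?thesis by blast
qed

end
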